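(* Let $L$ be a set of $n\ge 2$ lines in $\mathbb{R}^3$. Then either there is a subset of $\sqrt n$ lines of $L$ that are all stabbed by one line, or there is a subset of $\Omega\left(\left(n/\log n\right)^{1/5}\right)$ lines of $L$ such that no $6$-subset of it is stabbed by one line.
   Context: A set $S$ of lines in $\mathbb{R}^3$ is stabbed by a line $m$ of $\mathbb{R}^3$ if $m$ intersects every line of $S$. The notation $\Omega(f(n))$ denotes a quantity at least $c\,f(n)$ for an absolute constant $c>0$ independent of $n$ and $L$. *)

theory Defs
  imports "HOL-Analysis.Analysis"
begin

definition is_line :: "(real ^ 3) set \<Rightarrow> bool" where
  "is_line l \<longleftrightarrow> affine l \<and> aff_dim l = 1"

definition stabs :: "(real ^ 3) set \<Rightarrow> (real ^ 3) set set \<Rightarrow> bool" where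
  "stabs m S \<longleftrightarrow> (\<forall>l\<in>S. m \<inter> l \<noteq> {})"

definition stabbed_by_one_line :: "(real ^ 3) set set \<Rightarrow> bool" where
  "stabbed_by_one_line S \<longleftrightarrow> (\<exists>m. is_line m \<and> stabs m S)"

end

theory Submission
  imports Defs
begin

text \<open>Suppose that every stabbed subset of \<open>L\<close> has at most \<open>\<surd>n\<close> elements. It suffices to show that
  only \<open>O(n\<^sup>5)\<close> of the 6-subsets of \<open>L\<close> are stabbed: deletion in this 6-uniform hypergraph then gives
  an independent set of size \<open>\<Omega>(n\<^sup>1\<^sup>/\<^sup>5)\<close>, which is even better than required.

  For the count, four members \<open>a b c d\<close> of a stabbed 6-set can be chosen so that the other two are among
  the lines met by at most 12 lines that depend only on \<open>a b c d\<close>; so the other two can be chosen in at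
  most \<open>(12 \<surd>n)\<^sup>2\<close> ways. If some member meets two others, it serves as \<open>a\<close>. Otherwise take disjoint
  members \<open>a\<close> and \<open>b\<close>. Their common stabbers are the secants joining the point of \<open>a\<close> with parameter \<open>s\<close>
  to the point of \<open>b\<close> with parameter \<open>t\<close>, and those coplanar with a line \<open>x\<close> are the zeros of a
  polynomial \<open>A s t + B s + C t + D\<close>. The zero set of such a polynomial is covered by two rational
  curves, and the polynomial of \<open>x\<close> has few zeros on a curve or vanishes on all of it. So \<open>a b c x\<close>
  have few common stabbers, or \<open>x\<close> is coplanar with a whole curve of secants, of which only finitely many
  are parallel to \<open>x\<close>. In the latter case a generic secant of the curve stabs all these \<open>x\<close> in \<open>L\<close>.\<close>

subsection \<open>Lines and secants\<close>

lemma is_line_param: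
  assumes "is_line l"
  shows "\<exists>a u. u \<noteq> 0 \<and> l = range (\<lambda>t. a + t *\<^sub>R u)"
proof -
  obtain B where B: "\<not> affine_dependent B" "affine hull B = affine hull l"
      "of_nat (card B) = aff_dim l + 1"
    using aff_dim_basis_exists by blast
  then have "card B = 2" using assms by (simp add: is_line_def)
  then obtain p q where pq: "B = {p, q}" "p \<noteq> q" by (auto simp: card_2_iff)
  have hull_l: "affine hull l = l" using assms by (simp add: is_line_def affine_hull_eq)
  have "l = affine hull {p, q}" using B(2) unfolding hull_l pq(1) by (rule sym)
  moreover have "q - p \<noteq> 0" using pq(2) by simp
  ultimately have "l = range (\<lambda>t. p + t *\<^sub>R (q - p))" "q - p \<noteq> 0"
    by (simp_all add: affine_hull_2_alt)
  then show ?thesis by blast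
qed

lemma is_line_affine_hull_2: "p \<noteq> q \<Longrightarrow> is_line (affine hull {p, q})"
  by (simp add: is_line_def aff_dim_affine_hull aff_dim_2)

lemma is_line_eq_affine_hull_2:
  assumes "is_line m" "p \<in> m" "q \<in> m" "p \<noteq> q"
  shows "m = affine hull {p, q}"
proof -
  have "affine hull {p, q} \<subseteq> m"
    using assms by (intro hull_minimal) (auto simp: is_line_def)
  moreover have "aff_dim (affine hull {p, q}) = aff_dim m" "affine m"
    using assms by (auto simp: is_line_def aff_dim_affine_hull aff_dim_2)
  ultimately show ?thesis
    by (metis affine_affine_hull affine_dim_equal affine_hull_eq_empty insert_not_empty)
qed

text \<open>\<open>line_base\<close> and \<open>line_dir\<close> project the same chosen pair, so
  together they parametrize \<open>l\<close>.\<close>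

definition line_base :: "(real^3) set \<Rightarrow> real^3" where
  "line_base l = fst (SOME p. snd p \<noteq> 0 \<and> l = range (\<lambda>t. fst p + t *\<^sub>R snd p))"

definition line_dir :: "(real^3) set \<Rightarrow> real^3" where
  "line_dir l = snd (SOME p. snd p \<noteq> 0 \<and> l = range (\<lambda>t. fst p + t *\<^sub>R snd p))"

definition line_pt :: "(real^3) set \<Rightarrow> real \<Rightarrow> real^3" where
  "line_pt l t = line_base l + t *\<^sub>R line_dir l"

lemma is_line_dir_pt:
  assumes "is_line l"
  shows "line_dir l \<noteq> 0" "l = range (line_pt l)"
proof -
  have "\<exists>p. snd p \<noteq> 0 \<and> l = range (\<lambda>t. fst p + t *\<^sub>R snd p)"
    using is_line_param[OF assms] by auto
  from someI_ex[OF this] show "line_dir l \<noteq> 0" "l = range (line_pt l)"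
    unfolding line_dir_def line_base_def line_pt_def by auto
qed

definition secant :: "(real^3) set \<Rightarrow> (real^3) set \<Rightarrow> real \<Rightarrow> real \<Rightarrow> (real^3) set" where
  "secant a b s t = affine hull {line_pt a s, line_pt b t}"

text \<open>\<open>copl\<close> vanishes iff the secant and \<open>x\<close> are coplanar, \<open>par\<close> iff they are parallel or equal.\<close>

definition copl :: "(real^3) set \<Rightarrow> (real^3) set \<Rightarrow> (real^3) set \<Rightarrow> real \<Rightarrow> real \<Rightarrow> real" where
  "copl a b x s t =
     cross3 (line_pt a s - line_base x) (line_dir x) \<bullet> (line_pt b t - line_base x)"

definition par :: "(real^3) set \<Rightarrow> (real^3) set \<Rightarrow> (real^3) set \<Rightarrow> real \<Rightarrow> real \<Rightarrow> real^3" where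
  "par a b x s t = cross3 (line_dir x) (line_pt b t - line_pt a s)"

lemma line_pt_in: "is_line l \<Longrightarrow> line_pt l t \<in> l"
  using is_line_dir_pt(2) by blast

lemma disjoint_pt_neq:
  "is_line a \<Longrightarrow> is_line b \<Longrightarrow> a \<inter> b = {} \<Longrightarrow> line_pt a s \<noteq> line_pt b t"
  using line_pt_in by (metis disjoint_iff)

lemma is_line_secant:
  "is_line a \<Longrightarrow> is_line b \<Longrightarrow> a \<inter> b = {} \<Longrightarrow> is_line (secant a b s t)"
  unfolding secant_def by (intro is_line_affine_hull_2 disjoint_pt_neq)

lemma meets_both_secant:
  assumes "is_line a" "is_line b" "a \<inter> b = {}" "is_line m" "m \<inter> a \<noteq> {}" "m \<inter> b \<noteq> {}"
  obtains s t where "m = secant a b s t"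
proof -
  obtain p q where pq: "p \<in> m" "p \<in> a" "q \<in> m" "q \<in> b" using assms(5,6) by blast
  obtain s where s: "p = line_pt a s" using pq(2) is_line_dir_pt(2)[OF assms(1)] by auto
  obtain t where t: "q = line_pt b t" using pq(4) is_line_dir_pt(2)[OF assms(2)] by auto
  have "m = secant a b s t"
    unfolding secant_def using is_line_eq_affine_hull_2[OF assms(4)]
      disjoint_pt_neq[OF assms(1-3)] pq unfolding s t by blast
  then show ?thesis by (rule that)
qed

text \<open>A point of the line through \<open>X\<close> and \<open>Y\<close> that is a multiple of
  \<open>z\<close> makes \<open>X\<close>, \<open>Y\<close>, \<open>z\<close> linearly dependent:
  for \<open>l = 0\<close>, \<open>X\<close> is a multiple of \<open>z\<close>; otherwise
  \<open>Y\<close> is a combination of \<open>X\<close> and \<open>z\<close>.\<close>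

lemma triple_zero_if_combination:
  fixes X Y z :: "real^3"
  assumes "X + l *\<^sub>R (Y - X) = \<mu> *\<^sub>R z"
  shows "cross3 X z \<bullet> Y = 0"
proof (cases "l = 0")
  case True
  then have "X = \<mu> *\<^sub>R z" using assms by simp
  then show ?thesis by (simp add: cross_mult_left)
next
  case False
  have "l *\<^sub>R Y = \<mu> *\<^sub>R z - (1 - l) *\<^sub>R X" using assms by (simp add: algebra_simps)
  then have "cross3 X z \<bullet> (l *\<^sub>R Y) = 0"
    by (simp add: inner_diff_right dot_cross_self)
  with False show ?thesis by simp
qed

text \<open>The vectors \<open>z\<close>, \<open>d\<close> and \<open>n = cross3 z d\<close> form a
  basis. In the expansion of \<open>X\<close> the coefficient of \<open>n\<close> is a multiple of
  the triple product, hence zero.\<close>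

lemma combination_if_triple_zero:
  fixes X d z :: "real^3"
  assumes "cross3 X z \<bullet> d = 0" "cross3 z d \<noteq> 0"
  shows "\<exists>l \<mu>. X + l *\<^sub>R d = \<mu> *\<^sub>R z"
proof -
  define n where "n = cross3 z d"
  have "(n \<bullet> n) *\<^sub>R X = (cross3 X d \<bullet> n) *\<^sub>R z + (cross3 z X \<bullet> n) *\<^sub>R d + (cross3 X z \<bullet> d) *\<^sub>R n"
    unfolding n_def
    by (simp add: vec_eq_iff forall_3 cross3_def inner_vec_def sum_3) (simp add: algebra_simps)
  then have "(n \<bullet> n) *\<^sub>R X = (cross3 X d \<bullet> n) *\<^sub>R z + (cross3 z X \<bullet> n) *\<^sub>R d"
    using assms(1) by simp
  moreover have nn: "n \<bullet> n \<noteq> 0" using assms(2) n_def by simp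
  ultimately have "inverse (n \<bullet> n) *\<^sub>R ((n \<bullet> n) *\<^sub>R X)
      = inverse (n \<bullet> n) *\<^sub>R ((cross3 X d \<bullet> n) *\<^sub>R z + (cross3 z X \<bullet> n) *\<^sub>R d)"
    by simp
  then have "X = ((cross3 X d \<bullet> n) / (n \<bullet> n)) *\<^sub>R z + ((cross3 z X \<bullet> n) / (n \<bullet> n)) *\<^sub>R d"
    using nn by (simp add: scaleR_add_right divide_inverse_commute)
  then have "X + (- ((cross3 z X \<bullet> n) / (n \<bullet> n))) *\<^sub>R d = ((cross3 X d \<bullet> n) / (n \<bullet> n)) *\<^sub>R z"
    by (simp add: algebra_simps)
  then show ?thesis by blast
qed

lemma secant_meets_imp_copl:
  assumes "is_line x" "secant a b s t \<inter> x \<noteq> {}"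
  shows "copl a b x s t = 0"
proof -
  obtain l \<mu> where
    "line_pt a s + l *\<^sub>R (line_pt b t - line_pt a s) = line_base x + \<mu> *\<^sub>R line_dir x"
    using assms(2) is_line_dir_pt(2)[OF assms(1)]
    unfolding secant_def affine_hull_2_alt line_pt_def by blast
  then have "(line_pt a s - line_base x)
      + l *\<^sub>R ((line_pt b t - line_base x) - (line_pt a s - line_base x)) = \<mu> *\<^sub>R line_dir x"
    by (simp add: algebra_simps)
  then show ?thesis unfolding copl_def by (rule triple_zero_if_combination)
qed

lemma copl_imp_secant_meets:
  assumes "is_line x" "copl a b x s t = 0" "par a b x s t \<noteq> 0"
  shows "secant a b s t \<inter> x \<noteq> {}"
proof -
  let ?X = "line_pt a s - line_base x" and ?d = "line_pt b t - line_pt a s"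
  have Y: "line_pt b t - line_base x = ?X + ?d" by simp
  have "cross3 ?X (line_dir x) \<bullet> ?d = 0"
    using assms(2) unfolding copl_def Y inner_add_right by (simp add: dot_cross_self)
  with assms(3) obtain l \<mu> where "?X + l *\<^sub>R ?d = \<mu> *\<^sub>R line_dir x"
    using combination_if_triple_zero unfolding par_def by blast
  then have "line_pt a s + l *\<^sub>R ?d = line_pt x \<mu>"
    by (simp add: line_pt_def algebra_simps)
  moreover have "line_pt a s + l *\<^sub>R ?d \<in> secant a b s t"
    unfolding secant_def affine_hull_2_alt by blast
  ultimately show ?thesis using line_pt_in[OF assms(1)] by fastforce
qed

text \<open>A line that is parallel to a secant and meets it is that secant, so it contains both
  defining points. Hence a line that misses \<open>a\<close> or \<open>b\<close> is never parallel
  to a secant that it meets.\<close>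

lemma secant_meets_par:
  assumes "is_line a" "is_line b" "a \<inter> b = {}" "is_line x"
    and "secant a b s t \<inter> x \<noteq> {}" "par a b x s t = 0"
  shows "x \<inter> a \<noteq> {} \<and> x \<inter> b \<noteq> {}"
proof -
  let ?d = "line_pt b t - line_pt a s"
  have d0: "?d \<noteq> 0" using disjoint_pt_neq[OF assms(1-3)] by (metis right_minus_eq)
  have z0: "line_dir x \<noteq> 0" using is_line_dir_pt assms by blast
  obtain k where k: "?d = k *\<^sub>R line_dir x"
    using assms(6) z0 unfolding par_def cross_eq_0 collinear_lemma by auto
  obtain l \<mu> where "line_pt a s + l *\<^sub>R ?d = line_base x + \<mu> *\<^sub>R line_dir x"
    using assms(5) is_line_dir_pt(2)[OF assms(4)]
    unfolding secant_def affine_hull_2_alt line_pt_def[of x] by blast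
  then have "line_pt a s = line_pt x (\<mu> - l * k)"
    unfolding k by (simp add: line_pt_def algebra_simps)
  moreover from this have "line_pt b t = line_pt x (\<mu> - l * k + k)"
    using k by (simp add: line_pt_def algebra_simps)
  ultimately show ?thesis using line_pt_in assms by (metis disjoint_iff)
qed

lemma copl_bilinear:
  obtains A B C D where "\<And>s t. copl a b x s t = A * s * t + B * s + C * t + D"
proof
  fix s t
  let ?z = "line_dir x" and ?p = "line_base a - line_base x" and ?q = "line_base b - line_base x"
  have 1: "line_pt a s - line_base x = ?p + s *\<^sub>R line_dir a"
          "line_pt b t - line_base x = ?q + t *\<^sub>R line_dir b"
    by (simp_all add: line_pt_def)
  show "copl a b x s t = (cross3 (line_dir a) ?z \<bullet> line_dir b) * s * t
      + (cross3 (line_dir a) ?z \<bullet> ?q) * s + (cross3 ?p ?z \<bullet> line_dir b) * t + cross3 ?p ?z \<bullet> ?q"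
    unfolding copl_def 1
    by (simp only: cross_add_left cross_mult_left inner_add_left inner_add_right
        inner_scaleR_left inner_scaleR_right) (simp add: algebra_simps)
qed

lemma par_affine:
  obtains G U V where "\<And>s t. par a b x s t = G + t *\<^sub>R V - s *\<^sub>R U"
proof
  fix s t
  show "par a b x s t = cross3 (line_dir x) (line_base b - line_base a)
      + t *\<^sub>R cross3 (line_dir x) (line_dir b) - s *\<^sub>R cross3 (line_dir x) (line_dir a)"
    unfolding par_def line_pt_def
    by (simp add: cross_add_right Cross3.right_diff_distrib cross_mult_right)
qed

subsection \<open>Rational curves of secants\<close>

text \<open>Each such \<open>x\<close> is parallel to the moving secant for finitely many parameters
  only. Since \<open>L\<close> is finite, one \<open>w\<close> avoids all of these, and there
  coplanarity gives intersection for every such \<open>x\<close> at once.\<close>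

lemma curve_generic_secant:
  fixes \<sigma> \<tau> \<delta> :: "real poly"
  assumes ab: "is_line a" "is_line b" "a \<inter> b = {}"
    and L: "finite L" "\<And>x. x \<in> L \<Longrightarrow> is_line x" and "\<delta> \<noteq> 0"
  obtains m where "is_line m"
    "\<And>x. x \<in> L \<Longrightarrow> (\<And>w. poly \<delta> w \<noteq> 0 \<Longrightarrow> copl a b x (poly \<sigma> w / poly \<delta> w) (poly \<tau> w / poly \<delta> w) = 0)
       \<Longrightarrow> \<exists>w. poly \<delta> w \<noteq> 0 \<and> par a b x (poly \<sigma> w / poly \<delta> w) (poly \<tau> w / poly \<delta> w) \<noteq> 0
       \<Longrightarrow> m \<inter> x \<noteq> {}"
proof -
  define s where "s w = poly \<sigma> w / poly \<delta> w" for w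
  define t where "t w = poly \<tau> w / poly \<delta> w" for w
  define X where "X = {x \<in> L. \<exists>w. poly \<delta> w \<noteq> 0 \<and> par a b x (s w) (t w) \<noteq> 0}"
  have "finite {w. poly \<delta> w \<noteq> 0 \<and> par a b x (s w) (t w) = 0}" if "x \<in> X" for x
  proof -
    obtain w0 where w0: "poly \<delta> w0 \<noteq> 0" "par a b x (s w0) (t w0) \<noteq> 0"
      using \<open>x \<in> X\<close> by (auto simp: X_def)
    obtain G U V where G: "\<And>s t. par a b x s t = G + t *\<^sub>R V - s *\<^sub>R U"
      by (rule par_affine) blast
    define n where "n = par a b x (s w0) (t w0)"
    \<comment> \<open>Clearing \<open>\<delta>\<close> from the component of \<open>par\<close>
      along its own value \<open>n\<close> at \<open>w0\<close> gives a polynomial that does not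
      vanish at \<open>w0\<close>.\<close>
    define H where "H = smult (n \<bullet> G) \<delta> + smult (n \<bullet> V) \<tau> - smult (n \<bullet> U) \<sigma>"
    have H: "poly H w = poly \<delta> w * (n \<bullet> par a b x (s w) (t w))" if "poly \<delta> w \<noteq> 0" for w
      using that unfolding H_def G s_def t_def
      by (simp add: inner_add_right inner_diff_right field_simps)
    have "n \<bullet> n \<noteq> 0" using w0(2) by (simp add: n_def)
    then have "poly H w0 \<noteq> 0" using H[OF w0(1)] w0(1) by (simp flip: n_def)
    then have "finite {w. poly H w = 0}" by (intro poly_roots_finite) auto
    then show ?thesis by (rule rev_finite_subset) (auto simp: H)
  qed
  moreover have "finite X" using L(1) by (simp add: X_def)
  ultimately have "finite ({w. poly \<delta> w = 0} \<union> (\<Union>x\<in>X. {w. poly \<delta> w \<noteq> 0 \<and> par a b x (s w) (t w) = 0}))"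
    using poly_roots_finite[OF \<open>\<delta> \<noteq> 0\<close>] by blast
  from ex_new_if_finite[OF infinite_UNIV_char_0 this]
  obtain w where w: "poly \<delta> w \<noteq> 0" "\<And>x. x \<in> X \<Longrightarrow> par a b x (s w) (t w) \<noteq> 0"
    by blast
  show thesis
  proof
    show "is_line (secant a b (s w) (t w))" by (rule is_line_secant[OF ab])
    fix x
    assume x: "x \<in> L" and
      c: "\<And>w. poly \<delta> w \<noteq> 0 \<Longrightarrow> copl a b x (poly \<sigma> w / poly \<delta> w) (poly \<tau> w / poly \<delta> w) = 0" and
      p: "\<exists>w. poly \<delta> w \<noteq> 0 \<and> par a b x (poly \<sigma> w / poly \<delta> w) (poly \<tau> w / poly \<delta> w) \<noteq> 0"
    have "x \<in> X" using x p by (simp add: X_def s_def t_def)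
    then show "secant a b (s w) (t w) \<inter> x \<noteq> {}"
      using copl_imp_secant_meets[OF L(2)[OF x]] c[OF w(1)] w(2) by (simp add: s_def t_def)
  qed
qed

text \<open>Substituting the curve into the bilinear form of \<open>copl\<close> and clearing the
  square of \<open>\<delta>\<close> yields a polynomial \<open>P\<close> of degree at most 4, which
  is zero or has at most 4 roots.\<close>

lemma curve_dichotomy:
  fixes \<sigma> \<tau> \<delta> :: "real poly" and a b x :: "(real^3) set"
  assumes deg: "degree \<sigma> \<le> 2" "degree \<tau> \<le> 2" "degree \<delta> \<le> 2"
  defines "Z \<equiv> {w. poly \<delta> w \<noteq> 0 \<and> copl a b x (poly \<sigma> w / poly \<delta> w) (poly \<tau> w / poly \<delta> w) = 0}"
  shows "(\<forall>w. poly \<delta> w \<noteq> 0 \<longrightarrow> copl a b x (poly \<sigma> w / poly \<delta> w) (poly \<tau> w / poly \<delta> w) = 0)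
    \<or> (finite Z \<and> card Z \<le> 4)"
proof -
  obtain A B C D where c: "\<And>s t. copl a b x s t = A * s * t + B * s + C * t + D"
    by (rule copl_bilinear) blast
  define P where "P = smult A (\<sigma> * \<tau>) + smult B (\<sigma> * \<delta>) + smult C (\<tau> * \<delta>) + smult D (\<delta> * \<delta>)"
  have P: "poly P w = (poly \<delta> w)\<^sup>2 * copl a b x (poly \<sigma> w / poly \<delta> w) (poly \<tau> w / poly \<delta> w)"
    if "poly \<delta> w \<noteq> 0" for w
    using that unfolding P_def c by (simp add: power2_eq_square field_simps)
  have "degree (p * q) \<le> 4" if "degree p \<le> 2" "degree q \<le> 2" for p q :: "real poly"
    using degree_mult_le[of p q] that by linarith
  then have degP: "degree P \<le> 4"
    unfolding P_def using deg
    by (intro degree_add_le order.trans[OF degree_smult_le]) auto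
  show ?thesis
  proof (cases "P = 0")
    case True
    then show ?thesis using P by force
  next
    case False
    have sub: "Z \<subseteq> {w. poly P w = 0}" using P by (auto simp: Z_def)
    have fin: "finite {w. poly P w = 0}" using False by (rule poly_roots_finite)
    have "card Z \<le> degree P"
      using card_mono[OF fin sub] card_poly_roots_bound[OF False] by linarith
    then show ?thesis using finite_subset[OF sub fin] degP by simp
  qed
qed

section \<open>Secants of a rational curve that meet a given line\<close>

definition common_secants ::
    "(real^3) set \<Rightarrow> (real^3) set \<Rightarrow> (real^3) set \<Rightarrow> (real^3) set \<Rightarrow> (real \<times> real) set" where
  "common_secants a b c d =
     {(s, t). secant a b s t \<inter> c \<noteq> {} \<and> secant a b s t \<inter> d \<noteq> {}}"

text \<open>The bound 8 allows 4 points on each of the two rational curves that cover the zeros of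
  \<open>copl a b c\<close> when it is not identically zero.\<close>

definition few_common_secants ::
    "(real^3) set \<Rightarrow> (real^3) set \<Rightarrow> (real^3) set \<Rightarrow> (real^3) set \<Rightarrow> bool" where
  "few_common_secants a b c d \<longleftrightarrow>
     finite (common_secants a b c d) \<and> card (common_secants a b c d) \<le> 8"

text \<open>For \<open>\<delta> = 0\<close> this is the empty set, not the point that division by
  zero would produce.\<close>

definition curve_points :: "real poly \<Rightarrow> real poly \<Rightarrow> real poly \<Rightarrow> (real \<times> real) set" where
  "curve_points \<sigma> \<tau> \<delta> = {(poly \<sigma> w / poly \<delta> w, poly \<tau> w / poly \<delta> w) |w. poly \<delta> w \<noteq> 0}"

text \<open>The line \<open>m\<close> is a generic secant of the curve. If \<open>copl a b x\<close>
  vanishes along the curve and some secant of it meets \<open>x\<close>, that secant is not parallel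
  to \<open>x\<close>, because \<open>x\<close> misses \<open>a\<close> or \<open>b\<close>; so
  \<open>m\<close> meets \<open>x\<close>. Otherwise at most 4 parameters remain.\<close>

lemma curve_stabber:
  fixes \<sigma> \<tau> \<delta> :: "real poly"
  assumes ab: "is_line a" "is_line b" "a \<inter> b = {}"
    and L: "finite L" "\<And>x. x \<in> L \<Longrightarrow> is_line x" and "\<delta> \<noteq> 0"
    and deg: "degree \<sigma> \<le> 2" "degree \<tau> \<le> 2" "degree \<delta> \<le> 2"
  obtains m where "is_line m"
    "\<And>x. x \<in> L \<Longrightarrow> x \<inter> a = {} \<or> x \<inter> b = {} \<Longrightarrow>
        m \<inter> x \<noteq> {} \<or> finite (curve_points \<sigma> \<tau> \<delta> \<inter> {(s, t). secant a b s t \<inter> x \<noteq> {}}) \<and>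
          card (curve_points \<sigma> \<tau> \<delta> \<inter> {(s, t). secant a b s t \<inter> x \<noteq> {}}) \<le> 4"
proof -
  obtain m where m: "is_line m"
    "\<And>x. x \<in> L \<Longrightarrow> (\<And>w. poly \<delta> w \<noteq> 0 \<Longrightarrow> copl a b x (poly \<sigma> w / poly \<delta> w) (poly \<tau> w / poly \<delta> w) = 0)
       \<Longrightarrow> \<exists>w. poly \<delta> w \<noteq> 0 \<and> par a b x (poly \<sigma> w / poly \<delta> w) (poly \<tau> w / poly \<delta> w) \<noteq> 0
       \<Longrightarrow> m \<inter> x \<noteq> {}"
    by (rule curve_generic_secant[OF ab L(1) _ \<open>\<delta> \<noteq> 0\<close>, of \<sigma> \<tau>]) (use L(2) in blast)+
  have "m \<inter> x \<noteq> {} \<or> finite Z \<and> card Z \<le> 4"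
    if x: "x \<in> L" "x \<inter> a = {} \<or> x \<inter> b = {}"
      and Z: "Z = curve_points \<sigma> \<tau> \<delta> \<inter> {(s, t). secant a b s t \<inter> x \<noteq> {}}" for x Z
  proof -
    let ?s = "\<lambda>w. poly \<sigma> w / poly \<delta> w" and ?t = "\<lambda>w. poly \<tau> w / poly \<delta> w"
    let ?W = "{w. poly \<delta> w \<noteq> 0 \<and> copl a b x (?s w) (?t w) = 0}"
    note lx = L(2)[OF x(1)]
    have Zsub: "Z \<subseteq> (\<lambda>w. (?s w, ?t w)) ` ?W"
      using secant_meets_imp_copl[OF lx, of a b] unfolding Z curve_points_def by blast
    have np: "par a b x s t \<noteq> 0" if "(s, t) \<in> Z" for s t
      using secant_meets_par[OF ab lx] x(2) that unfolding Z by blast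
    consider "Z = {}" | "Z \<noteq> {}" "\<forall>w. poly \<delta> w \<noteq> 0 \<longrightarrow> copl a b x (?s w) (?t w) = 0"
      | "finite ?W" "card ?W \<le> 4"
      using curve_dichotomy[OF deg, of a b x] by blast
    then show ?thesis
    proof cases
      case 2
      then obtain w where "poly \<delta> w \<noteq> 0" "(?s w, ?t w) \<in> Z"
        unfolding Z curve_points_def by blast
      then have "m \<inter> x \<noteq> {}" using m(2)[OF x(1)] 2(2) np by blast
      then show ?thesis ..
    next
      case 3
      have "finite Z" "card Z \<le> card ?W"
        using surj_card_le[OF 3(1) Zsub] finite_subset[OF Zsub] 3(1) by auto
      with 3 show ?thesis by simp
    qed simp
  qed
  then show thesis using that[OF m(1)] by blast
qed

text \<open>When \<open>copl a b c\<close> does not vanish identically, its zeros \<open>(A s + C) t + (B s + D) = 0\<close> form at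
  most one vertical line and the graph of \<open>t = - (B s + D) / (A s + C)\<close>, both rational curves.\<close>

lemma two_curves_cover:
  assumes "\<not> (\<forall>s t. copl a b c s t = 0)"
  obtains \<sigma> \<tau> \<delta> \<sigma>' where "degree \<sigma> \<le> 2" "degree \<tau> \<le> 2" "degree \<delta> \<le> 2" "degree \<sigma>' \<le> 2"
    "\<And>s t. copl a b c s t = 0 \<Longrightarrow>
        (s, t) \<in> curve_points \<sigma> \<tau> \<delta> \<union> curve_points \<sigma>' [:0, 1:] 1"
proof -
  obtain A B C D where c: "\<And>s t. copl a b c s t = A * s * t + B * s + C * t + D"
    by (rule copl_bilinear) blast
  \<comment> \<open>Two different such \<open>s\<close> would force \<open>A\<close>,
    \<open>B\<close>, \<open>C\<close>, \<open>D\<close> to vanish, against the assumption. So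
    \<open>s0\<close> marks the only possible vertical line.\<close>
  obtain s0 where s0: "s = s0" if "A * s + C = 0" "B * s + D = 0" for s
  proof (cases "A = 0")
    case False
    show ?thesis
    proof (rule that[of "- C / A"])
      fix s assume "A * s + C = 0"
      then show "s = - C / A" using False by (simp add: field_simps eq_neg_iff_add_eq_0)
    qed
  next
    case True
    show ?thesis
    proof (rule that[of "- D / B"])
      fix s assume s: "A * s + C = 0" "B * s + D = 0"
      have "B \<noteq> 0"
      proof
        assume "B = 0"
        then show False using s True assms c by simp
      qed
      then show "s = - D / B" using s by (simp add: field_simps eq_neg_iff_add_eq_0)
    qed
  qed
  show thesis
  proof (rule that)
    \<comment> \<open>The graph is parametrized by \<open>s\<close> itself, written as
      \<open>s * (A * s + C) / (A * s + C)\<close> to share the denominator of \<open>t\<close>;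
      this causes the degree 2.\<close>
    show "degree ([:0, C, A:] :: real poly) \<le> 2" "degree [:- D, - B:] \<le> 2" "degree [:C, A:] \<le> 2" "degree [:s0:] \<le> 2"
      by (simp_all add: degree_pCons_eq_if)
    fix s t assume "copl a b c s t = 0"
    then have z: "(A * s + C) * t = - (B * s + D)" unfolding c by (simp add: algebra_simps)
    show "(s, t) \<in> curve_points [:0, C, A:] [:- D, - B:] [:C, A:] \<union> curve_points [:s0:] [:0, 1:] 1"
    proof (cases "A * s + C = 0")
      case True
      then have "s = s0" using z s0 by simp
      then show ?thesis unfolding curve_points_def by auto
    next
      case False
      then have "t = - (B * s + D) / (A * s + C)" using z by (simp add: field_simps)
      moreover have "s = poly [:0, C, A:] s / poly [:C, A:] s"
        using False by (simp add: field_simps)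
      ultimately have "(s, t) = (poly [:0, C, A:] s / poly [:C, A:] s, poly [:- D, - B:] s / poly [:C, A:] s)"
        "poly [:C, A:] s \<noteq> 0"
        using False by (simp_all add: algebra_simps)
      then show ?thesis unfolding curve_points_def by blast
    qed
  qed
qed

text \<open>Here \<open>copl\<close> vanishes along every curve, so it remains to pick one along
  which no such \<open>x\<close> stays parallel to the secants.\<close>

lemma coplanar_family_stabber:
  assumes ab: "is_line a" "is_line b" "a \<inter> b = {}"
    and L: "finite L" "\<And>x. x \<in> L \<Longrightarrow> is_line x"
  obtains m where "is_line m"
    "\<And>x s t. x \<in> L \<Longrightarrow> x \<inter> a = {} \<or> x \<inter> b = {} \<Longrightarrow> \<forall>s t. copl a b x s t = 0 \<Longrightarrow>
        secant a b s t \<inter> x \<noteq> {} \<Longrightarrow> m \<inter> x \<noteq> {}"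
proof -
  \<comment> \<open>\<open>par\<close> is affine in \<open>(s, t)\<close>, so it cannot vanish on the parabola \<open>t = s\<^sup>2\<close> without vanishing identically.\<close>
  let ?\<sigma> = "[:0, 1:] :: real poly" and ?\<tau> = "[:0, 0, 1:] :: real poly"
  obtain m where m: "is_line m"
    "\<And>x. x \<in> L \<Longrightarrow> (\<And>w. poly 1 w \<noteq> (0::real) \<Longrightarrow> copl a b x (poly ?\<sigma> w / poly 1 w) (poly ?\<tau> w / poly 1 w) = 0)
       \<Longrightarrow> \<exists>w. poly 1 w \<noteq> (0::real) \<and> par a b x (poly ?\<sigma> w / poly 1 w) (poly ?\<tau> w / poly 1 w) \<noteq> 0
       \<Longrightarrow> m \<inter> x \<noteq> {}"
    by (rule curve_generic_secant[OF ab L(1) _ one_neq_zero, of ?\<sigma> ?\<tau>]) (use L(2) in blast)+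
  have "m \<inter> x \<noteq> {}"
    if x: "x \<in> L" "x \<inter> a = {} \<or> x \<inter> b = {}" "\<forall>s t. copl a b x s t = 0" "secant a b s t \<inter> x \<noteq> {}" for x s t
  proof -
    obtain G U V where G: "\<And>s t. par a b x s t = G + t *\<^sub>R V - s *\<^sub>R U"
      by (rule par_affine) blast
    have "\<exists>w. par a b x w (w * w) \<noteq> 0"
    proof (rule ccontr)
      assume "\<nexists>w. par a b x w (w * w) \<noteq> 0"
      \<comment> \<open>The parameters 0, 1 and -1 suffice to isolate \<open>G\<close>,
        \<open>V - U\<close> and \<open>V + U\<close>.\<close>
      then have "par a b x 0 (0 * 0) = 0" "par a b x 1 (1 * 1) = 0" "par a b x (- 1) ((- 1) * (- 1)) = 0"
        by blast+
      then have "G = 0" "V - U = 0" "V + U = 0" unfolding G by simp_all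
      then have "V + V = 0" by (metis diff_eq_eq add_0 add.commute)
      then have "G = 0" "V = 0" "U = 0"
        using \<open>G = 0\<close> \<open>V - U = 0\<close> by (simp_all flip: scaleR_2)
      then have "par a b x s t = 0" unfolding G by simp
      then show False using secant_meets_par[OF ab L(2)[OF x(1)] x(4)] x(2) by blast
    qed
    then show ?thesis using m(2)[OF x(1)] x(3) by simp
  qed
  then show thesis using that m(1) by blast
qed

text \<open>Each of the two covering curves has its own generic secant. Secants that meet
  \<open>c\<close> come from these curves, so a line \<open>x\<close> missed by both
  \<open>m\<close> and \<open>m'\<close> shares at most 4 + 4 of them with \<open>c\<close>.\<close>

lemma noncoplanar_family_stabbers:
  assumes ab: "is_line a" "is_line b" "a \<inter> b = {}"
    and L: "finite L" "\<And>x. x \<in> L \<Longrightarrow> is_line x"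
    and c: "is_line c" "\<not> (\<forall>s t. copl a b c s t = 0)"
  obtains m m' where "is_line m" "is_line m'"
    "\<And>x. x \<in> L \<Longrightarrow> x \<inter> a = {} \<or> x \<inter> b = {} \<Longrightarrow>
      m \<inter> x \<noteq> {} \<or> m' \<inter> x \<noteq> {} \<or>
      few_common_secants a b c x"
proof -
  obtain \<sigma> \<tau> \<delta> \<sigma>' where deg: "degree \<sigma> \<le> 2" "degree \<tau> \<le> 2" "degree \<delta> \<le> 2" "degree \<sigma>' \<le> 2"
    and cov: "\<And>s t. copl a b c s t = 0 \<Longrightarrow>
        (s, t) \<in> curve_points \<sigma> \<tau> \<delta> \<union> curve_points \<sigma>' [:0, 1:] 1"
    by (rule two_curves_cover[OF c(2)]) (rule that)
  have deg': "degree [:0, 1::real:] \<le> 2" "degree (1 :: real poly) \<le> 2" by simp_all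
  let ?I = "\<lambda>x. {(s, t). secant a b s t \<inter> x \<noteq> {}}"
  let ?Z = "\<lambda>x. curve_points \<sigma> \<tau> \<delta> \<inter> ?I x" and ?Z' = "\<lambda>x. curve_points \<sigma>' [:0, 1:] 1 \<inter> ?I x"
  obtain m where m: "is_line m"
    "\<And>x. x \<in> L \<Longrightarrow> x \<inter> a = {} \<or> x \<inter> b = {} \<Longrightarrow> m \<inter> x \<noteq> {} \<or> finite (?Z x) \<and> card (?Z x) \<le> 4"
  proof (cases "\<delta> = 0")
    case True
    \<comment> \<open>The curve is empty, so any line serves as \<open>m\<close>; \<open>a\<close>
      is at hand.\<close>
    then have "curve_points \<sigma> \<tau> \<delta> = {}" by (simp add: curve_points_def)
    then show ?thesis using that[OF ab(1)] by simp
  next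
    case False
    show ?thesis
      by (rule curve_stabber[OF ab L(1) L(2) False deg(1-3)]) (assumption, rule that)
  qed
  obtain m' where m': "is_line m'"
    "\<And>x. x \<in> L \<Longrightarrow> x \<inter> a = {} \<or> x \<inter> b = {} \<Longrightarrow> m' \<inter> x \<noteq> {} \<or> finite (?Z' x) \<and> card (?Z' x) \<le> 4"
    by (rule curve_stabber[OF ab L(1) L(2) one_neq_zero deg(4) deg']) (assumption, rule that)
  have "few_common_secants a b c x"
    if "finite (?Z x) \<and> card (?Z x) \<le> 4" "finite (?Z' x) \<and> card (?Z' x) \<le> 4" for x
  proof -
    have sub: "common_secants a b c x \<subseteq> ?Z x \<union> ?Z' x"
      using cov secant_meets_imp_copl[OF c(1), of a b] unfolding common_secants_def by blast
    have fin: "finite (?Z x \<union> ?Z' x)" using that by simp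
    have "card (?Z x \<union> ?Z' x) \<le> 8" using card_Un_le[of "?Z x" "?Z' x"] that by linarith
    then show ?thesis
      unfolding few_common_secants_def using finite_subset[OF sub fin] card_mono[OF fin sub] by linarith
  qed
  then have "m \<inter> x \<noteq> {} \<or> m' \<inter> x \<noteq> {} \<or> few_common_secants a b c x"
    if "x \<in> L" "x \<inter> a = {} \<or> x \<inter> b = {}" for x
    using m(2)[OF that] m'(2)[OF that] by metis
  then show thesis by (rule that[OF m(1) m'(1)])
qed

text \<open>For fixed \<open>a b c d\<close>, the controlled lines are stabbed by boundedly many lines. The four rules are the
  ways in which two members \<open>e f\<close> of a stabbed 6-set can be confined by the other four.\<close>

inductive controlled :: "(real^3) set \<Rightarrow> (real^3) set \<Rightarrow> (real^3) set \<Rightarrow> (real^3) set \<Rightarrow> (real^3) set \<Rightarrow> bool"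
  for a b c d where
  meets: "a \<inter> x \<noteq> {} \<Longrightarrow> controlled a b c d x"
| coplanar: "a \<inter> b = {} \<Longrightarrow> x \<inter> a = {} \<or> x \<inter> b = {} \<Longrightarrow> \<forall>s t. copl a b x s t = 0 \<Longrightarrow>
    secant a b s t \<inter> x \<noteq> {} \<Longrightarrow> controlled a b c d x"
| many: "a \<inter> b = {} \<Longrightarrow> x \<inter> a = {} \<or> x \<inter> b = {} \<Longrightarrow> \<not> (\<forall>s t. copl a b c s t = 0) \<Longrightarrow>
    \<not> few_common_secants a b c x \<Longrightarrow> controlled a b c d x"
| few: "a \<inter> b = {} \<Longrightarrow> few_common_secants a b c d \<Longrightarrow> (s, t) \<in> common_secants a b c d \<Longrightarrow>
    secant a b s t \<inter> x \<noteq> {} \<Longrightarrow> controlled a b c d x"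

text \<open>The bound is 4 + 8: \<open>a\<close> handles rule \<open>meets\<close>,
  \<open>m0\<close> handles \<open>coplanar\<close>, \<open>m\<close> and \<open>m'\<close> handle
  \<open>many\<close>, and the at most 8 secants in \<open>K\<close> handle \<open>few\<close>. If
  \<open>a\<close> and \<open>b\<close> intersect, only \<open>meets\<close> can apply.\<close>

lemma controlled_lines_stabbers:
  assumes L: "finite L" "\<And>x. x \<in> L \<Longrightarrow> is_line x" and "a \<in> L" "b \<in> L" "c \<in> L"
  shows "\<exists>M. finite M \<and> card M \<le> 12 \<and> (\<forall>m\<in>M. is_line m) \<and>
    (\<forall>x\<in>L. controlled a b c d x \<longrightarrow> (\<exists>m\<in>M. m \<inter> x \<noteq> {}))"
proof (cases "a \<inter> b = {}")
  case False
  have "a \<inter> x \<noteq> {}" if "controlled a b c d x" for x using that False by cases auto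
  then show ?thesis using L(2)[OF \<open>a \<in> L\<close>] by (intro exI[of _ "{a}"]) simp
next
  case ab: True
  note lines = L(2)[OF \<open>a \<in> L\<close>] L(2)[OF \<open>b \<in> L\<close>] ab
  obtain m0 where m0: "is_line m0"
    "\<And>x s t. x \<in> L \<Longrightarrow> x \<inter> a = {} \<or> x \<inter> b = {} \<Longrightarrow> \<forall>s t. copl a b x s t = 0 \<Longrightarrow>
        secant a b s t \<inter> x \<noteq> {} \<Longrightarrow> m0 \<inter> x \<noteq> {}"
    by (rule coplanar_family_stabber[OF lines L]) (assumption, rule that)
  obtain m m' where m: "is_line m" "is_line m'"
    "\<And>x. \<not> (\<forall>s t. copl a b c s t = 0) \<Longrightarrow> x \<in> L \<Longrightarrow> x \<inter> a = {} \<or> x \<inter> b = {} \<Longrightarrow>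
      m \<inter> x \<noteq> {} \<or> m' \<inter> x \<noteq> {} \<or> few_common_secants a b c x"
  proof (cases "\<forall>s t. copl a b c s t = 0")
    case True
    then show ?thesis using that[OF lines(1) lines(1)] by simp
  next
    case False
    show ?thesis
      by (rule noncoplanar_family_stabbers[OF lines L L(2)[OF \<open>c \<in> L\<close>] False]) (assumption, rule that)
  qed
  define K where "K = (if few_common_secants a b c d
    then (\<lambda>(s, t). secant a b s t) ` common_secants a b c d else {})"
  have K: "finite K" "card K \<le> 8"
    unfolding K_def few_common_secants_def by (auto intro: order.trans[OF card_image_le])
  have Kl: "is_line x" if "x \<in> K" for x
    using that is_line_secant[OF lines] unfolding K_def by (auto split: if_splits)
  define M where "M = {a, m0, m, m'} \<union> K"
  have "card {a, m0, m, m'} \<le> 4" by (simp add: card_insert_if)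
  then have "card M \<le> 12" using card_Un_le[of "{a, m0, m, m'}" K] K(2) unfolding M_def by linarith
  moreover have "finite M" using K(1) by (simp add: M_def)
  moreover have "\<forall>x\<in>M. is_line x" using lines(1) m0(1) m(1,2) Kl by (auto simp: M_def)
  moreover have "\<exists>m\<in>M. m \<inter> x \<noteq> {}" if "x \<in> L" "controlled a b c d x" for x
    using that(2)
  proof cases
    case meets
    then show ?thesis by (auto simp: M_def)
  next
    case (coplanar s t)
    then have "m0 \<inter> x \<noteq> {}" using m0(2)[OF \<open>x \<in> L\<close>] by simp
    then show ?thesis by (auto simp: M_def)
  next
    case many
    then have "m \<inter> x \<noteq> {} \<or> m' \<inter> x \<noteq> {}" using m(3)[OF _ \<open>x \<in> L\<close>] by simp
    then show ?thesis by (auto simp: M_def)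
  next
    case (few s t)
    then have "secant a b s t \<in> M" unfolding M_def K_def by force
    then show ?thesis using few(4) by blast
  qed
  ultimately show ?thesis by (intro exI[of _ M]) simp
qed

subsection \<open>Counting stabbed 6-sets\<close>

lemma ex_two_elements: "2 \<le> card A \<Longrightarrow> \<exists>x\<in>A. \<exists>y\<in>A. x \<noteq> y"
proof -
  assume "2 \<le> card A"
  then obtain B where "B \<subseteq> A" "card B = 2" by (rule obtain_subset_with_card_n)
  then show ?thesis by (auto simp: card_2_iff)
qed

text \<open>If no member meets two others, fix disjoint \<open>a\<close> and \<open>b\<close>. If
  two of the other four are coplanar with all secants, they are \<open>e\<close> and
  \<open>f\<close>. Otherwise some \<open>c\<close> is not; either some \<open>d\<close> has few
  common secants with \<open>c\<close>, which confines all the rest, or all three remaining lines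
  fall under \<open>many\<close>.\<close>

lemma stabbed_six_set_enumeration:
  assumes L: "\<And>x. x \<in> L \<Longrightarrow> is_line x"
    and T: "T \<subseteq> L" "card T = 6" "stabbed_by_one_line T"
  shows "\<exists>a b c d e f. T = {a, b, c, d, e, f} \<and> controlled a b c d e \<and> controlled a b c d f"
proof (cases "\<exists>a\<in>T. \<exists>e\<in>T. \<exists>f\<in>T. a \<noteq> e \<and> a \<noteq> f \<and> e \<noteq> f \<and> a \<inter> e \<noteq> {} \<and> a \<inter> f \<noteq> {}")
  case True
  then obtain a e f where aef: "a \<in> T" "e \<in> T" "f \<in> T" "a \<noteq> e" "a \<noteq> f" "e \<noteq> f"
      "a \<inter> e \<noteq> {}" "a \<inter> f \<noteq> {}" by blast
  have "card (T - {a, e, f}) = 3"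
    using T(2) aef(1-6) by (subst card_Diff_subset) auto
  then obtain b c d where bcd: "T - {a, e, f} = {b, c, d}" by (auto simp: card_3_iff)
  have "T = {a, e, f} \<union> {b, c, d}" using Diff_partition[of "{a, e, f}" T] bcd aef by simp
  then have "T = {a, b, c, d, e, f}" by (simp add: insert_commute)
  moreover have "controlled a b c d e" "controlled a b c d f" by (rule controlled.meets, fact)+
  ultimately show ?thesis by blast
next
  case False
  then have sparse: "x \<inter> y = {} \<or> x \<inter> z = {}"
    if "x \<in> T" "y \<in> T" "z \<in> T" "x \<noteq> y" "x \<noteq> z" "y \<noteq> z" for x y z
    using that by metis
  obtain m where m: "is_line m" "\<And>x. x \<in> T \<Longrightarrow> m \<inter> x \<noteq> {}"
    using T(3) unfolding stabbed_by_one_line_def stabs_def by blast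
  obtain a where a: "a \<in> T" using T(2) by fastforce
  have "card (T - {a}) = 5" using T(2) a by simp
  then obtain e f where ef: "e \<in> T" "f \<in> T" "a \<noteq> e" "a \<noteq> f" "e \<noteq> f"
    using ex_two_elements[of "T - {a}"] by auto
  \<comment> \<open>Since \<open>a\<close> meets at most one of \<open>e\<close> and
    \<open>f\<close>, the other can serve as \<open>b\<close>.\<close>
  obtain b where b: "b \<in> T" "b \<noteq> a" "a \<inter> b = {}"
    using sparse[OF a ef] ef that by metis
  define R where "R = T - {a, b}"
  have R: "card R = 4" unfolding R_def using T(2) a b by (simp add: card_Diff_subset)
  have T_eq: "T = {a, b} \<union> R" unfolding R_def using a b by blast
  \<comment> \<open>A line of \<open>R\<close> that meets both \<open>a\<close> and \<open>b\<close>
    would be a member meeting two others.\<close>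
  have disj: "x \<inter> a = {} \<or> x \<inter> b = {}" if "x \<in> R" for x
    using sparse[of x a b] that a b(1,2) unfolding R_def by simp
  have abL: "a \<in> L" "b \<in> L" using a b T(1) by auto
  obtain s t where st: "m = secant a b s t"
    by (rule meets_both_secant[OF L[OF abL(1)] L[OF abL(2)] b(3) m(1) m(2)[OF a] m(2)[OF b(1)]])
  have hit: "secant a b s t \<inter> x \<noteq> {}" if "x \<in> R" for x
    using m(2)[of x] that unfolding st R_def by blast
  show ?thesis
  proof (cases "\<exists>e\<in>R. \<exists>f\<in>R. e \<noteq> f \<and> (\<forall>s t. copl a b e s t = 0) \<and> (\<forall>s t. copl a b f s t = 0)")
    case True
    then obtain e f where ef: "e \<in> R" "f \<in> R" "e \<noteq> f"
      "\<forall>s t. copl a b e s t = 0" "\<forall>s t. copl a b f s t = 0" by blast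
    then have "card (R - {e, f}) = 2" using R by (subst card_Diff_subset) auto
    then obtain c d where cd: "R - {e, f} = {c, d}" by (auto simp: card_2_iff)
    have "R = {e, f} \<union> {c, d}" using Diff_partition[of "{e, f}" R] cd ef by simp
    then have T6: "T = {a, b, c, d, e, f}" using T_eq by (simp add: insert_commute)
    have "controlled a b c d x" if "x \<in> R" "\<forall>s t. copl a b x s t = 0" for x
      by (rule controlled.coplanar[OF b(3) disj[OF that(1)] that(2) hit[OF that(1)]])
    from this[OF ef(1,4)] this[OF ef(2,5)] T6 show ?thesis by blast
  next
    case False
    obtain e f where "e \<in> R" "f \<in> R" "e \<noteq> f" using R ex_two_elements[of R] by auto
    then obtain c where c: "c \<in> R" "\<not> (\<forall>s t. copl a b c s t = 0)" using False by blast
    have R': "card (R - {c}) = 3" using R c by simp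
    show ?thesis
    proof (cases "\<exists>d\<in>R - {c}. few_common_secants a b c d")
      case True
      then obtain d where d: "d \<in> R - {c}" "few_common_secants a b c d" by blast
      then have "card (R - {c} - {d}) = 2" using R' by simp
      then obtain e f where ef: "R - {c} - {d} = {e, f}" by (auto simp: card_2_iff)
      have "R - {c} = {d} \<union> {e, f}" using Diff_partition[of "{d}" "R - {c}"] d ef by simp
      then have R_eq: "R = {c} \<union> ({d} \<union> {e, f})" using Diff_partition[of "{c}" R] c by simp
      then have T6: "T = {a, b, c, d, e, f}" using T_eq by (simp add: insert_commute)
      have st': "(s, t) \<in> common_secants a b c d"
        using hit[OF c(1)] hit[of d] d unfolding common_secants_def by blast
      have "controlled a b c d x" if "x \<in> R" for x
        by (rule controlled.few[OF b(3) d(2) st' hit[OF that]])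
      moreover have "e \<in> R" "f \<in> R" using R_eq by simp_all
      ultimately show ?thesis using T6 by blast
    next
      case large: False
      \<comment> \<open>Rule \<open>many\<close> puts no condition on \<open>d\<close>, so the three
        lines can be named in any order.\<close>
      obtain d e f where def: "R - {c} = {d, e, f}" using R' by (auto simp: card_3_iff)
      then have "R = {c} \<union> {d, e, f}" using Diff_partition[of "{c}" R] c by simp
      then have T6: "T = {a, b, c, d, e, f}" using T_eq by (simp add: insert_commute)
      have "controlled a b c d x" if "x \<in> R - {c}" for x
        by (rule controlled.many[OF b(3) disj c(2)]) (use large that in auto)
      then have "controlled a b c d e" "controlled a b c d f" unfolding def by simp_all
      then show ?thesis using T6 by blast
    qed
  qed
qed

text \<open>Every stabbed 6-set comes from a quadruple, with \<open>card L ^ 4\<close> choices, and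
  two lines of \<open>U\<close> for that quadruple. This \<open>U\<close> is a union of at most 12
  stabbed subsets of \<open>L\<close>, each of size at most \<open>r\<close>.\<close>

lemma card_stabbed_six_sets:
  assumes L: "finite L" "\<And>x. x \<in> L \<Longrightarrow> is_line x"
    and small: "\<And>S. S \<subseteq> L \<Longrightarrow> stabbed_by_one_line S \<Longrightarrow> real (card S) \<le> r"
  shows "real (card {T. T \<subseteq> L \<and> card T = 6 \<and> stabbed_by_one_line T}) \<le> real (card L) ^ 4 * (12 * r)\<^sup>2"
proof -
  define stabbers where "stabbers a b c d M \<longleftrightarrow> finite M \<and> card M \<le> 12 \<and> (\<forall>m\<in>M. is_line m) \<and>
    (\<forall>x\<in>L. controlled a b c d x \<longrightarrow> (\<exists>m\<in>M. m \<inter> x \<noteq> {}))" for a b c d M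
  define M where "M a b c d = (SOME M. stabbers a b c d M)" for a b c d
  have M: "stabbers a b c d (M a b c d)" if "a \<in> L" "b \<in> L" "c \<in> L" for a b c d
    unfolding M_def using controlled_lines_stabbers[OF L that, of d, folded stabbers_def] by (rule someI_ex)
  define U where "U = (\<lambda>(a, b, c, d). \<Union>m\<in>M a b c d. {x\<in>L. m \<inter> x \<noteq> {}})"
  let ?Q = "L \<times> L \<times> L \<times> L"
  have U: "finite (U q)" "real (card (U q)) \<le> 12 * r" if "q \<in> ?Q" for q
  proof -
    obtain a b c d where q: "q = (a, b, c, d)" by (cases q)
    then have abc: "a \<in> L" "b \<in> L" "c \<in> L" using that by simp_all
    have Mq: "finite (M a b c d)" "card (M a b c d) \<le> 12" "\<And>m. m \<in> M a b c d \<Longrightarrow> is_line m" 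
      using M[OF abc, of d] unfolding stabbers_def by simp_all
    have r: "real (card {x\<in>L. m \<inter> x \<noteq> {}}) \<le> r" if "m \<in> M a b c d" for m
      using Mq(3)[OF that] by (intro small) (auto simp: stabbed_by_one_line_def stabs_def)
    \<comment> \<open>The empty set is stabbed by any line, for instance by
      \<open>a\<close>.\<close>
    have "0 \<le> r" using small[of "{}"] L(2) abc(1)
      unfolding stabbed_by_one_line_def stabs_def by auto
    have "real (card (U q)) \<le> (\<Sum>m\<in>M a b c d. real (card {x\<in>L. m \<inter> x \<noteq> {}}))"
      unfolding U_def q by (simp flip: of_nat_sum) (rule card_UN_le[OF Mq(1)])
    also have "\<dots> \<le> real (card (M a b c d)) * r" using r by (intro sum_bounded_above)
    also have "\<dots> \<le> 12 * r" using Mq(2) \<open>0 \<le> r\<close> by (intro mult_right_mono) auto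
    finally show "real (card (U q)) \<le> 12 * r" .
    show "finite (U q)" unfolding U_def q using Mq(1) L(1) by simp
  qed
  let ?P = "SIGMA q:?Q. U q \<times> U q"
  let ?h = "\<lambda>((a, b, c, d), (e, f)). {a, b, c, d, e, f}"
  have finP: "finite ?P" using L(1) U(1) by (intro finite_SigmaI) auto
  have "{T. T \<subseteq> L \<and> card T = 6 \<and> stabbed_by_one_line T} \<subseteq> ?h ` ?P"
  proof
    fix T assume "T \<in> {T. T \<subseteq> L \<and> card T = 6 \<and> stabbed_by_one_line T}"
    then have T: "T \<subseteq> L" "card T = 6" "stabbed_by_one_line T" by auto
    obtain a b c d e f where 1: "T = {a, b, c, d, e, f}"
      "controlled a b c d e" "controlled a b c d f"
      using stabbed_six_set_enumeration[OF L(2) T] by blast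
    then have inL: "a \<in> L" "b \<in> L" "c \<in> L" "d \<in> L" "e \<in> L" "f \<in> L" using T(1) by simp_all
    have "\<exists>m\<in>M a b c d. m \<inter> x \<noteq> {}" if "x \<in> L" "controlled a b c d x" for x
      using M[OF inL(1-3), of d] that unfolding stabbers_def by simp
    from this[OF inL(5) 1(2)] this[OF inL(6) 1(3)] inL
    have "((a, b, c, d), (e, f)) \<in> ?P" unfolding U_def by auto
    then show "T \<in> ?h ` ?P" using 1(1) by (intro image_eqI[of _ _ "((a, b, c, d), (e, f))"]) auto
  qed
  then have "card {T. T \<subseteq> L \<and> card T = 6 \<and> stabbed_by_one_line T} \<le> card ?P"
    using finP by (rule surj_card_le[rotated])
  then have "real (card {T. T \<subseteq> L \<and> card T = 6 \<and> stabbed_by_one_line T}) \<le> real (card ?P)"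
    by (rule of_nat_mono)
  also have "card ?P = (\<Sum>q\<in>?Q. card (U q \<times> U q))"
    by (rule card_SigmaI) (use L(1) U(1) in \<open>simp, blast\<close>)
  also have "real \<dots> = (\<Sum>q\<in>?Q. real (card (U q)) * real (card (U q)))"
    by (simp only: card_cartesian_product of_nat_sum of_nat_mult)
  also have "\<dots> \<le> real (card ?Q) * (12 * r)\<^sup>2"
    unfolding power2_eq_square
    by (intro sum_bounded_above mult_mono U order.trans[OF of_nat_0_le_iff U(2)]) auto
  also have "real (card ?Q) = real (card L) ^ 4"
    by (simp add: card_cartesian_product numeral_eq_Suc)
  finally show ?thesis .
qed

subsection \<open>Sparse uniform hypergraphs\<close>

text \<open>Deleting a vertex of maximum degree removes at least the fraction \<open>r / N\<close> of the edges, and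
  \<open>1 - r / N \<le> (1 - 1 / N) ^ r\<close>; hence the edge count divided by \<open>N ^ r\<close> never increases.\<close>

lemma uniform_hypergraph_sparse_subset:
  fixes V :: "'a set" and r k :: nat
  assumes V: "finite V" and E: "\<And>T. T \<in> E \<Longrightarrow> T \<subseteq> V \<and> card T = r" and "k \<le> card V"
  shows "\<exists>S\<subseteq>V. card S = k \<and> real (card {T\<in>E. T \<subseteq> S}) * real (card V) ^ r \<le> real (card E) * real k ^ r"
  using \<open>k \<le> card V\<close>
proof (induction rule: inc_induct)
  case base
  have "{T\<in>E. T \<subseteq> V} = E" using E by blast
  then show ?case by auto
next
  case (step k)
  then obtain S where S: "S \<subseteq> V" "card S = Suc k"
    and IH: "real (card {T\<in>E. T \<subseteq> S}) * real (card V) ^ r \<le> real (card E) * real (Suc k) ^ r"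
    by blast
  define F where "F = {T\<in>E. T \<subseteq> S}"
  have finS: "finite S" using S V finite_subset by blast
  then have finF: "finite F" by (rule_tac finite_subset[of _ "Pow S"]) (auto simp: F_def)
  \<comment> \<open>Double counting of the incidences between vertices and edges.\<close>
  have "(\<Sum>v\<in>S. card {T\<in>F. v \<in> T}) = r * card F"
  proof (rule sum_multicount[OF finS finF], intro ballI)
    fix T assume "T \<in> F"
    then have "{v \<in> S. v \<in> T} = T" "card T = r" using E by (auto simp: F_def)
    then show "card {v \<in> S. v \<in> T} = r" by simp
  qed
  then have total: "(\<Sum>v\<in>S. real (card {T\<in>F. v \<in> T})) = real r * real (card F)"
    by (metis of_nat_mult of_nat_sum)
  \<comment> \<open>Some vertex has at least the average degree.\<close>
  obtain v where v: "v \<in> S" "real r * real (card F) / real (Suc k) \<le> real (card {T\<in>F. v \<in> T})"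
  proof (rule ccontr)
    assume "\<not> thesis"
    then have "\<And>v. v \<in> S \<Longrightarrow> real (card {T\<in>F. v \<in> T}) < real r * real (card F) / real (Suc k)"
      using that by fastforce
    then have "(\<Sum>v\<in>S. real (card {T\<in>F. v \<in> T})) < (\<Sum>v\<in>S. real r * real (card F) / real (Suc k))"
      using finS S(2) by (intro sum_strict_mono) auto
    then show False using total S(2) by simp
  qed
  have remaining: "{T\<in>E. T \<subseteq> S - {v}} = F - {T\<in>F. v \<in> T}" by (auto simp: F_def)
  have "card (F - {T\<in>F. v \<in> T}) + card {T\<in>F. v \<in> T} = card F"
    using finF by (metis (no_types, lifting) card_Diff_subset card_mono finite_subset le_add_diff_inverse2
        mem_Collect_eq subsetI)
  then have "real (card {T\<in>E. T \<subseteq> S - {v}}) = real (card F) - real (card {T\<in>F. v \<in> T})"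
    unfolding remaining by linarith
  also have "\<dots> \<le> real (card F) * (1 + real r * (- 1 / real (Suc k)))"
    using v(2) by (simp add: algebra_simps)
  also have "\<dots> \<le> real (card F) * (1 + (- 1 / real (Suc k))) ^ r"
    by (intro mult_left_mono Bernoulli_inequality) (auto simp: field_simps)
  also have "1 + (- 1 / real (Suc k)) = real k / real (Suc k)" by (simp add: field_simps)
  finally have "real (card {T\<in>E. T \<subseteq> S - {v}}) * real (Suc k) ^ r \<le> real (card F) * real k ^ r"
    by (simp add: power_divide field_simps)
  then have "real (card {T\<in>E. T \<subseteq> S - {v}}) * real (Suc k) ^ r * real (card V) ^ r
      \<le> real (card F) * real k ^ r * real (card V) ^ r"
    by (rule mult_right_mono) simp
  also have "\<dots> = (real (card F) * real (card V) ^ r) * real k ^ r" by simp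
  also have "\<dots> \<le> (real (card E) * real (Suc k) ^ r) * real k ^ r"
    using IH by (intro mult_right_mono) (simp_all add: F_def)
  finally have "real (Suc k) ^ r * (real (card {T\<in>E. T \<subseteq> S - {v}}) * real (card V) ^ r)
      \<le> real (Suc k) ^ r * (real (card E) * real k ^ r)"
    by (simp only: mult_ac)
  then have "real (card {T\<in>E. T \<subseteq> S - {v}}) * real (card V) ^ r \<le> real (card E) * real k ^ r"
    by (rule mult_left_le_imp_le) simp
  moreover have "S - {v} \<subseteq> V" "card (S - {v}) = k" using S v(1) finS by auto
  ultimately show ?case by blast
qed

text \<open>Removing one vertex of each edge inside a sparse \<open>k\<close>-subset destroys all
  its edges and costs at most as many vertices as there are such edges. Edges are nonempty because
  \<open>0 < r\<close>.\<close>

lemma uniform_hypergraph_independent_set: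
  fixes V :: "'a set" and r k :: nat
  assumes V: "finite V" and E: "\<And>T. T \<in> E \<Longrightarrow> T \<subseteq> V \<and> card T = r" and "0 < r" "k \<le> card V"
  shows "\<exists>S\<subseteq>V. (\<forall>T\<in>E. \<not> T \<subseteq> S) \<and>
    (real k - real (card S)) * real (card V) ^ r \<le> real (card E) * real k ^ r"
proof -
  obtain S where S: "S \<subseteq> V" "card S = k"
    and le: "real (card {T\<in>E. T \<subseteq> S}) * real (card V) ^ r \<le> real (card E) * real k ^ r"
    using uniform_hypergraph_sparse_subset[OF V E \<open>k \<le> card V\<close>] by blast
  define F where "F = {T\<in>E. T \<subseteq> S}"
  have finS: "finite S" using S V finite_subset by blast
  then have finF: "finite F" by (rule_tac finite_subset[of _ "Pow S"]) (auto simp: F_def)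
  have ne: "(SOME x. x \<in> T) \<in> T" if "T \<in> E" for T
    using E[OF that] \<open>0 < r\<close> by (metis card.empty ex_in_conv less_irrefl someI)
  define R where "R = (\<lambda>T. SOME x. x \<in> T) ` F"
  have "card R \<le> card F" unfolding R_def by (rule card_image_le[OF finF])
  moreover have "card S - card R \<le> card (S - R)"
    by (rule diff_card_le_card_Diff) (simp add: R_def finF)
  ultimately have "real k - real (card (S - R)) \<le> real (card F)" using S(2) by linarith
  then have "(real k - real (card (S - R))) * real (card V) ^ r \<le> real (card F) * real (card V) ^ r"
    by (rule mult_right_mono) simp
  also note le[folded F_def]
  finally have "(real k - real (card (S - R))) * real (card V) ^ r \<le> real (card E) * real k ^ r" .
  moreover have "\<not> T \<subseteq> S - R" if "T \<in> E" for T
    using ne[OF that] that by (auto simp: R_def F_def)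
  moreover have "S - R \<subseteq> V" using S by blast
  ultimately show ?thesis by blast
qed

section \<open>Choice of the constants and the deletion estimate\<close>

theorem theorem18:
  shows "\<exists>c::real. c > 0 \<and>
    (\<forall>(n::nat) (L :: (real ^ 3) set set).
       n \<ge> 2 \<and> finite L \<and> card L = n \<and> (\<forall>l\<in>L. is_line l) \<longrightarrow>
         (\<exists>S\<subseteq>L. real (card S) \<ge> sqrt (real n) \<and> stabbed_by_one_line S) \<or>
         (\<exists>S\<subseteq>L. real (card S) \<ge> c * (real n / ln (real n)) powr (1 / 5) \<and>
            (\<forall>T\<subseteq>S. card T = 6 \<longrightarrow> \<not> stabbed_by_one_line T)))"
proof (intro exI[of _ "1 / 16"] conjI allI impI)
  fix n :: nat and L :: "(real^3) set set"
  assume "n \<ge> 2 \<and> finite L \<and> card L = n \<and> (\<forall>l\<in>L. is_line l)"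
  then have n: "n \<ge> 2" "card L = n" and L: "finite L" "\<And>l. l \<in> L \<Longrightarrow> is_line l" by auto
  \<comment> \<open>There are at most 144 \<open>n ^ 5\<close> stabbed 6-sets, so deletion from a
    \<open>k\<close>-subset loses at most 144 \<open>k ^ 6 / n\<close> lines. This is at most
    \<open>k / 2\<close> once 288 \<open>k ^ 5\<close> is at most \<open>n\<close>, that is, for
    \<open>k\<close> up to \<open>y\<close>.\<close>
  define y where "y = (real n / 288) powr (1 / 5)"
  have y0: "0 < y" using n by (simp add: y_def)
  have y5: "y ^ 5 = real n / 288"
    using n by (simp add: y_def powr_powr flip: powr_realpow)
  have "1 / 2 \<le> ln (real n)"
  proof -
    have "ln 2 \<le> ln (real n)" using n by simp
    then show ?thesis using ln2_ge_two_thirds by linarith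
  qed
  then have "real n / ln (real n) \<le> real n / (1 / 2)"
    by (intro divide_left_mono) auto
  \<comment> \<open>As 1024 / 288 exceeds 2, the fifth root is at most \<open>4 * y\<close>.
    Rounding \<open>y\<close> down and deleting each cost at most a factor 2, leaving
    \<open>y / 4\<close>; hence the constant 1/16.\<close>
  also have "\<dots> \<le> 4 ^ 5 * (real n / 288)" by simp
  finally have "(real n / ln (real n)) powr (1 / 5) \<le> (4 ^ 5 * (real n / 288)) powr (1 / 5)"
    using n by (intro powr_mono2) auto
  also have "\<dots> = (4 ^ 5) powr (1 / 5) * y" unfolding y_def by (rule powr_mult)
  also have "(4 ^ 5) powr (1 / 5) = (4 powr 5) powr (1 / 5 :: real)" by (subst powr_realpow[symmetric]) auto
  also have "\<dots> = 4" by (simp only: powr_powr) simp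
  finally have target: "1 / 16 * (real n / ln (real n)) powr (1 / 5) \<le> y / 4" by simp
  show "(\<exists>S\<subseteq>L. real (card S) \<ge> sqrt (real n) \<and> stabbed_by_one_line S) \<or>
    (\<exists>S\<subseteq>L. real (card S) \<ge> 1 / 16 * (real n / ln (real n)) powr (1 / 5) \<and>
       (\<forall>T\<subseteq>S. card T = 6 \<longrightarrow> \<not> stabbed_by_one_line T))"
  proof (subst disj_imp, rule impI)
    assume none: "\<not> (\<exists>S\<subseteq>L. real (card S) \<ge> sqrt (real n) \<and> stabbed_by_one_line S)"
    have "real (card S) \<le> sqrt (real n)" if "S \<subseteq> L" "stabbed_by_one_line S" for S
    proof (rule ccontr)
      assume "\<not> real (card S) \<le> sqrt (real n)"
      then have "real (card S) \<ge> sqrt (real n)" by simp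
      with none that show False by blast
    qed
    note E_bound = card_stabbed_six_sets[OF L this]
    define E where "E = {T. T \<subseteq> L \<and> card T = 6 \<and> stabbed_by_one_line T}"
    have E: "real (card E) \<le> 144 * real n ^ 5"
      using E_bound n unfolding E_def by (simp add: power_mult_distrib numeral_eq_Suc)
    show "\<exists>S\<subseteq>L. real (card S) \<ge> 1 / 16 * (real n / ln (real n)) powr (1 / 5) \<and>
       (\<forall>T\<subseteq>S. card T = 6 \<longrightarrow> \<not> stabbed_by_one_line T)"
    proof (cases "y < 1")
      \<comment> \<open>The target size is now below 1, so a single line is enough.\<close>
      case True
      have "L \<noteq> {}" using n by auto
      then obtain l where "l \<in> L" by blast
      moreover have "card T \<noteq> 6" if "T \<subseteq> {l}" for T
        using card_mono[OF _ that] by auto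
      ultimately show ?thesis using target True by (intro exI[of _ "{l}"]) auto
    next
      case False
      define k where "k = nat \<lfloor>y\<rfloor>"
      have "1 \<le> \<lfloor>y\<rfloor>" using False by linarith
      moreover from this have "real k = real_of_int \<lfloor>y\<rfloor>" by (simp add: k_def)
      ultimately have k: "real k \<le> y" "y / 2 \<le> real k" by linarith+
      have k5: "288 * real k ^ 5 \<le> real n" using power_mono[OF k(1), of 5] y5 by simp
      have "k \<le> k ^ 5" by (cases k) (auto simp: self_le_power)
      then have "real k \<le> real k ^ 5" by (metis of_nat_le_iff of_nat_power)
      then have kn: "k \<le> n" using k5 by linarith
      have "T \<subseteq> L \<and> card T = 6" if "T \<in> E" for T using that by (simp add: E_def)
      from uniform_hypergraph_independent_set[OF L(1) this zero_less_numeral, of E k] kn n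
      obtain S where S: "S \<subseteq> L" "\<forall>T\<in>E. \<not> T \<subseteq> S"
        "(real k - real (card S)) * real n ^ 6 \<le> real (card E) * real k ^ 6" by auto
      have "real (card E) * real k ^ 6 \<le> 144 * real n ^ 5 * real k ^ 6"
        using E by (intro mult_right_mono) auto
      also have "\<dots> = (288 * real k ^ 5) * (real n ^ 5 * real k / 2)" by (simp add: numeral_eq_Suc)
      also have "\<dots> \<le> real n * (real n ^ 5 * real k / 2)"
        using k5 by (intro mult_right_mono) auto
      also have "\<dots> = (real k / 2) * real n ^ 6" by (simp add: numeral_eq_Suc)
      finally have "(real k - real (card S)) * real n ^ 6 \<le> (real k / 2) * real n ^ 6"
        using S(3) by linarith
      then have "real k - real (card S) \<le> real k / 2"
        by (rule mult_right_le_imp_le) (use n in simp)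
      then have "y / 4 \<le> real (card S)" using k by linarith
      moreover have "\<not> stabbed_by_one_line T" if "T \<subseteq> S" "card T = 6" for T
        using S(1,2) that unfolding E_def by blast
      ultimately show ?thesis using S(1) target by (intro exI[of _ S]) auto
    qed
  qed
qed simp

end
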